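(* Let $G=(V,E)$ be a connected undirected graph with $N$ nodes $v_1,\dots,v_N$, let $0<\underline a<\bar a<1$, and for every $k\ge 0$ let the weights satisfy $a_{j\to i}^{(k)}\in[\underline a,\bar a]$. Then the update rule $$x_i[k+1]=x_i[k]+\min_{v_j\in N_i\cup\{v_i\}}a_{j\to i}^{(k)}\,(x_j[k]-x_i[k]),\qquad k\ge0,\ i=1,\dots,N,$$ achieves minimum consensus, i.e. $$\lim_{k\to\infty}x_i[k]=\min_{1\le j\le N}x_j[0],\qquad i=1,2,\dots,N.$$
   Context: $N_i=\{v_j\in V:(v_i,v_j)\in E\}$ is the neighbor set of $v_i$, and $x_i[k]\in\mathbb{R}$ is the state of node $v_i$ at iteration $k$, with arbitrary initial states. The weight $a_{j\to i}^{(k)}$ is chosen at random by node $v_j$ at iteration $k$ within the confidential interaction protocol (in which node $v_i$ receives from $v_j$ the quantity $a_{j\to i}^{(k)}(x_j[k]-x_i[k])$ by encrypted exchange). The weights may vary with $k$ and need not be symmetric ($a_{j\to i}^{(k)}\ne a_{i\to j}^{(k)}$ is allowed); the statement holds for every realization of the weights in $[\underline a,\bar a]$. Encryption and quantization play no role in the statement. *)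

theory Defs
  imports Complex_Main "Graph_Theory.Graph_Theory"
begin

definition neighbors :: "'v pair_pre_digraph \<Rightarrow> 'v \<Rightarrow> 'v set" where
  "neighbors G i = {j \<in> pverts G. (i, j) \<in> parcs G}"

end

(* Every update is a convex combination of current states that cannot exceed the old state of the
   node. So each state is nonincreasing, stays above the initial minimum, and converges. In one step
   node i also falls by at least a_lo times its excess over any given neighbor, so the excess
   vanishes in the limit. Hence limits of adjacent nodes agree; by connectivity all limits agree,
   and their common value lies below the initial state of a node attaining the initial minimum. *)

theory Submission
  imports Defs
begin

text \<open>In the limit the increments of \<open>u\<close> vanish, so
  \<open>0 \<le> c * min 0 (M - L)\<close>, which for \<open>c > 0\<close> forces
  \<open>M - L\<close> to be nonnegative. The \<open>min 0\<close> lets one hypothesis cover the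
  steps where \<open>v\<close> lies above \<open>u\<close>; there it only asks that \<open>u\<close>
  not increase.\<close>

lemma limit_le_of_relative_descent:
  fixes u v :: "nat \<Rightarrow> real"
  assumes u: "u \<longlonglongrightarrow> L" and v: "v \<longlonglongrightarrow> M" and "0 < c"
    and step: "\<And>k. u (Suc k) - u k \<le> c * min 0 (v k - u k)"
  shows "L \<le> M"
proof -
  have "(\<lambda>k. u (Suc k) - u k) \<longlonglongrightarrow> L - L"
    by (intro tendsto_diff LIMSEQ_Suc u)
  moreover have "(\<lambda>k. c * min 0 (v k - u k)) \<longlonglongrightarrow> c * min 0 (M - L)"
    by (intro tendsto_intros u v)
  ultimately have "L - L \<le> c * min 0 (M - L)"
    using step by (intro LIMSEQ_le) auto
  then show ?thesis
    using \<open>0 < c\<close> by (auto simp: zero_le_mult_iff)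
qed

text \<open>Connectedness gives a path in the symmetric closure; equality of \<open>f\<close> at the
  two ends of an arc is unaffected by reversing the arc, so it propagates along the path.\<close>

lemma connected_const:
  assumes "Digraph_Component.connected G"
    and arc: "\<And>e. e \<in> arcs G \<Longrightarrow> f (tail G e) = f (head G e)"
    and "u \<in> verts G" "v \<in> verts G"
  shows "f u = f v"
proof -
  have "(u, v) \<in> rtrancl_on (verts G) (parcs (mk_symmetric G))"
    using assms by (auto simp: connected_def strongly_connected_def reachable_def)
  then show ?thesis
    by induction (auto simp: parcs_mk_symmetric arc)
qed

theorem theorem7:
  fixes N :: nat
    and G :: "nat pair_pre_digraph"
    and a :: "nat \<Rightarrow> nat \<Rightarrow> nat \<Rightarrow> real" (* a k j i: the weight from node j to node i at iteration k *)
    and x :: "nat \<Rightarrow> nat \<Rightarrow> real" (* x k i: the state of node i at iteration k *)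
    and a_lo a_hi :: real
  assumes graph: "pair_pseudo_graph G"
    and nodes: "pverts G = {1..N}"
    and conn: "Digraph_Component.connected (with_proj G)"
    and bounds: "0 < a_lo" "a_lo < a_hi" "a_hi < 1"
    and weights: "\<And>k i j. i \<in> {1..N} \<Longrightarrow> j \<in> neighbors G i \<union> {i} \<Longrightarrow> a k j i \<in> {a_lo..a_hi}"
    and update: "\<And>k i. i \<in> {1..N} \<Longrightarrow>
      x (Suc k) i = x k i + Min ((\<lambda>j. a k j i * (x k j - x k i)) ` (neighbors G i \<union> {i}))"
  shows "\<forall>i \<in> {1..N}. (\<lambda>k. x k i) \<longlonglongrightarrow> Min ((\<lambda>j. x 0 j) ` {1..N})"
proof -
  let ?V = "{1..N}"
  have arcD: "i \<in> ?V" "j \<in> neighbors G i" "(j, i) \<in> parcs G" if "(i, j) \<in> parcs G" for i j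
  proof -
    interpret pair_pseudo_graph G by (rule graph)
    show "i \<in> ?V" "j \<in> neighbors G i"
      using in_arcsD1[OF that] in_arcsD2[OF that] that by (simp_all add: nodes neighbors_def)
    show "(j, i) \<in> parcs G"
      using that by (rule arcs_symmetric)
  qed
  define m where "m = Min (x 0 ` ?V)"
  have nbrs_V: "neighbors G i \<subseteq> ?V" for i
    unfolding neighbors_def nodes by blast
  have fin: "finite (neighbors G i \<union> {i})" for i
    using finite_subset[OF nbrs_V[of i]] by simp
  have descent: "x (Suc k) i - x k i \<le> a k j i * (x k j - x k i)"
    if "i \<in> ?V" "j \<in> neighbors G i \<union> {i}" for k i j
  proof -
    let ?f = "\<lambda>j. a k j i * (x k j - x k i)"
    have "finite (?f ` (neighbors G i \<union> {i}))"
      using fin by (rule finite_imageI)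
    then have "Min (?f ` (neighbors G i \<union> {i})) \<le> ?f j"
      using that(2) by (rule Min_le[OF _ imageI])
    then show ?thesis
      using update[OF that(1), of k] by linarith
  qed
  have lower: "m \<le> x k i" if "i \<in> ?V" for k i
    using that
  proof (induction k arbitrary: i)
    case 0
    then show ?case by (simp add: m_def)
  next
    case (Suc k)
    \<comment> \<open>The minimum is attained at some \<open>j\<close>, so the new state is a convex
      combination of just two old states, both at least \<open>m\<close> by induction.\<close>
    have "Min ((\<lambda>j. a k j i * (x k j - x k i)) ` (neighbors G i \<union> {i}))
        \<in> (\<lambda>j. a k j i * (x k j - x k i)) ` (neighbors G i \<union> {i})"
      by (intro Min_in finite_imageI fin) simp
    then obtain j where "Min ((\<lambda>j. a k j i * (x k j - x k i)) ` (neighbors G i \<union> {i}))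
        = a k j i * (x k j - x k i)" and j: "j \<in> neighbors G i \<union> {i}"
      by (rule imageE)
    then have eq: "x (Suc k) i = x k i + a k j i * (x k j - x k i)"
      using update[OF Suc.prems, of k] by linarith
    have "a k j i \<in> {a_lo..a_hi}"
      using weights Suc.prems j by blast
    moreover have "j \<in> ?V"
      using j nbrs_V[of i] Suc.prems by blast
    then have "m \<le> x k i" "m \<le> x k j"
      using Suc.IH Suc.prems by blast+
    \<comment> \<open>The right-hand side is \<open>x (Suc k) i - m\<close>; \<open>a_hi < 1\<close>
      keeps the first coefficient nonnegative.\<close>
    ultimately have "0 \<le> (1 - a k j i) * (x k i - m) + a k j i * (x k j - m)"
      using bounds by (intro add_nonneg_nonneg mult_nonneg_nonneg) auto
    then show ?case
      unfolding eq by (simp add: algebra_simps)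
  qed
  have dec: "x (Suc k) i \<le> x k i" if "i \<in> ?V" for k i
    \<comment> \<open>The candidate \<open>j = i\<close> contributes zero to the minimum.\<close>
    using descent[OF that, of i] by simp
  have "\<exists>l. (\<lambda>k. x k i) \<longlonglongrightarrow> l" if "i \<in> ?V" for i
  proof -
    have "decseq (\<lambda>k. x k i)"
      using dec[OF that] by (rule decseq_SucI)
    then show ?thesis
      using decseq_convergent[of "\<lambda>k. x k i" m] lower[OF that] by blast
  qed
  then obtain L where L: "\<And>i. i \<in> ?V \<Longrightarrow> (\<lambda>k. x k i) \<longlonglongrightarrow> L i"
    by metis
  have le: "L i \<le> L j" if arc: "(i, j) \<in> parcs G" for i j
  proof (rule limit_le_of_relative_descent)
    have ij: "i \<in> ?V" "j \<in> ?V" "j \<in> neighbors G i \<union> {i}"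
      using arcD[OF arc] nbrs_V[of i] by blast+
    show "(\<lambda>k. x k i) \<longlonglongrightarrow> L i" "(\<lambda>k. x k j) \<longlonglongrightarrow> L j"
      using L ij by auto
    show "x (Suc k) i - x k i \<le> a_lo * min 0 (x k j - x k i)" for k
    proof (cases "x k j \<le> x k i")
      case True
      have "x (Suc k) i - x k i \<le> a k j i * (x k j - x k i)"
        using descent ij by blast
      \<comment> \<open>The difference is nonpositive here, so the smallest weight gives the weakest
        bound, and this bound is uniform in \<open>k\<close>.\<close>
      also have "\<dots> \<le> a_lo * (x k j - x k i)"
        using True weights[OF ij(1,3)] by (intro mult_right_mono_neg) auto
      finally show ?thesis using True by simp
    qed (use dec[OF ij(1)] in simp)
  qed (fact bounds)
  have const: "L i = L j" if "i \<in> ?V" "j \<in> ?V" for i j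
  proof (rule connected_const[OF conn])
    fix e
    assume "e \<in> arcs (with_proj G)"
    then have e: "(fst e, snd e) \<in> parcs G" by simp
    show "L (tail (with_proj G) e) = L (head (with_proj G) e)"
      \<comment> \<open>The reversed arc is also present and supplies the opposite
        inequality.\<close>
      using le[OF e] le[OF arcD(3)[OF e]] by simp
  qed (use that nodes in simp_all)
  have "(\<lambda>k. x k i) \<longlonglongrightarrow> m" if i: "i \<in> ?V" for i
  proof -
    have "m \<in> x 0 ` ?V"
      unfolding m_def using i by (intro Min_in) auto
    then obtain j where j: "j \<in> ?V" "m = x 0 j" by blast
    \<comment> \<open>A nonincreasing sequence stays above its limit, already at time 0.\<close>
    have "L j \<le> x 0 j"
      using decseq_ge[of "\<lambda>k. x k j" "L j" 0] decseq_SucI[of "\<lambda>k. x k j"] dec[OF j(1)] L[OF j(1)]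
      by simp
    then have "L i \<le> m"
      using const[OF i j(1)] j(2) by simp
    moreover have "m \<le> L i"
      using LIMSEQ_le_const[OF L[OF i]] lower[OF i] by blast
    ultimately show ?thesis
      using L[OF i] by simp
  qed
  then show ?thesis
    unfolding m_def by blast
qed

end
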